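(* Let $N\ge 2$, $\alpha,\beta>0$, let $\mathbf{e}\in\mathbb{R}_+^{N(N-1)/2}$ be the vector of pairwise squared nodal distances and $\mathbf{S}\in\{0,1\}^{N\times N(N-1)/2}$ the edge-to-degree map (both defined in the context). Let $\mathbf{w}^\star$ be the unique minimizer of $f(\mathbf{w})+g(\mathbf{S}\mathbf{w})$ over $\mathbf{w}\in\mathbb{R}^{N(N-1)/2}$, and let $\boldsymbol\lambda^\star\in\mathbb{R}^N$ be a minimizer of the dual objective $\varphi=F+G$. Let $L=\frac{N-1}{\beta}$, let $\boldsymbol\lambda_0\in\mathbb{R}^N$ be arbitrary, set $\boldsymbol\omega_1=\boldsymbol\lambda_0$, $t_1=1$, and for $k=1,2,\ldots$ define $$\bar{\mathbf{w}}_k=\max\Big(\mathbf{0},\tfrac{\mathbf{S}^\top\boldsymbol\omega_k-2\mathbf{e}}{2\beta}\Big),\qquad \mathbf{u}_k=\tfrac{1}{2}\Big(\mathbf{S}\bar{\mathbf{w}}_k-L\boldsymbol\omega_k+\sqrt{(\mathbf{S}\bar{\mathbf{w}}_k-L\boldsymbol\omega_k)^2+4\alpha L\mathbf{1}}\Big),$$ $$\boldsymbol\lambda_k=\boldsymbol\omega_k-L^{-1}(\mathbf{S}\bar{\mathbf{w}}_k-\mathbf{u}_k),\qquad t_{k+1}=\tfrac{1+\sqrt{1+4t_k^2}}{2},\qquad \boldsymbol\omega_{k+1}=\boldsymbol\lambda_k+\Big(\tfrac{t_k-1}{t_{k+1}}\Big)(\boldsymbol\lambda_k-\boldsymbol\lambda_{k-1}).$$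 Define the primal sequence $$\hat{\mathbf{w}}_k=\operatorname*{argmax}_{\mathbf{w}}\big\{\langle\mathbf{S}^\top\boldsymbol\lambda_k,\mathbf{w}\rangle-f(\mathbf{w})\big\}=\max\Big(\mathbf{0},\tfrac{\mathbf{S}^\top\boldsymbol\lambda_k-2\mathbf{e}}{2\beta}\Big).$$ Then for all $k\ge 1$, $$\|\hat{\mathbf{w}}_k-\mathbf{w}^\star\|_2\le\frac{\sqrt{2(N-1)}\,\|\boldsymbol\lambda_0-\boldsymbol\lambda^\star\|_2}{\beta k}.$$
   Context: Coordinates of vectors $\mathbf{w}\in\mathbb{R}^{N(N-1)/2}$ are indexed by unordered pairs $\{i,j\}$, $1\le i<j\le N$ (the upper-triangular entries of a symmetric hollow matrix $\mathbf{W}$). Given data vectors $\bar{\mathbf{x}}_1,\ldots,\bar{\mathbf{x}}_N\in\mathbb{R}^P$ (the measurements at each node), $\mathbf{e}$ has entries $e_{\{i,j\}}=\|\bar{\mathbf{x}}_i-\bar{\mathbf{x}}_j\|_2^2$. The matrix $\mathbf{S}$ maps edge weights to nodal degrees: $(\mathbf{S}\mathbf{w})_i=\sum_{j\ne i}w_{\{i,j\}}$, i.e. $\mathbf{S}\mathbf{w}=\mathbf{W}\mathbf{1}$. $f(\mathbf{w})=\mathbb{I}\{\mathbf{w}\succeq\mathbf{0}\}+2\mathbf{w}^\top\mathbf{e}+\beta\|\mathbf{w}\|_2^2$, where $\mathbb{I}\{\mathbf{w}\succeq\mathbf{0}\}=0$ if all entries of $\mathbf{w}$ are nonnegative and $+\infty$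 otherwise. $g(\mathbf{d})=-\alpha\sum_{i=1}^N\log d_i$ for $\mathbf{d}\in\mathbb{R}^N$ with all entries positive, and $g(\mathbf{d})=+\infty$ otherwise. The composite problem $\min_{\mathbf{w}}\{f(\mathbf{w})+g(\mathbf{S}\mathbf{w})\}$ has a unique solution. For $\boldsymbol\lambda\in\mathbb{R}^N$: $F(\boldsymbol\lambda)=\max_{\mathbf{w}}\{\langle\mathbf{S}^\top\boldsymbol\lambda,\mathbf{w}\rangle-f(\mathbf{w})\}$ and $G(\boldsymbol\lambda)=\sup_{\mathbf{d}}\{\langle-\boldsymbol\lambda,\mathbf{d}\rangle-g(\mathbf{d})\}$ (possibly $+\infty$); $\varphi=F+G$ is the (minimization-form) dual objective. The operations $\max(\cdot,\cdot)$, $(\cdot)^2$ and $\sqrt{\cdot}$ on vectors are element-wise, $\mathbf{1}$ is the all-ones vector. *)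

theory Defs
  imports "HOL-Analysis.Analysis" "HOL-Library.Cardinality"
begin

(* The N nodes form a type 'n with N = CARD('n); the class card2 says N >= 2, which is exactly
   what makes the type of unordered pairs of distinct nodes nonempty.
   Edge weight vectors in R^(N(N-1)/2) then have type real ^ ('n edge). *)
typedef (overloaded) ('n::card2) edge = "{A :: 'n set. card A = 2}"
  morphisms ends Abs_edge
proof -
  obtain A :: "'n set" where "card A = 2"
    using two_le_card[where 'a = 'n] obtain_subset_with_card_n[of 2 "UNIV :: 'n set"] by blast
  then show ?thesis by blast
qed

instance edge :: (card2) finite
proof
  have "inj (ends :: 'a edge \<Rightarrow> 'a set)"
    by (simp add: inj_on_def ends_inject)
  then show "finite (UNIV :: 'a edge set)"
    by (rule finite_imageD[rotated]) simp
qed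

definition mk_edge :: "'n::card2 \<Rightarrow> 'n \<Rightarrow> 'n edge" where
  "mk_edge i j = Abs_edge {i, j}"

lemma ends_mk_edge: "i \<noteq> j \<Longrightarrow> ends (mk_edge i j) = {i, j}"
  by (simp add: mk_edge_def Abs_edge_inverse)

lemma mk_edge_commute: "mk_edge i j = mk_edge j i"
  by (simp add: mk_edge_def insert_commute)

lemma mk_edge_eq_iff:
  "i \<noteq> j \<Longrightarrow> k \<noteq> l \<Longrightarrow> mk_edge i j = mk_edge k l \<longleftrightarrow> {i, j} = {k, l}"
  by (metis ends_inject ends_mk_edge)

lemma edge_cases:
  obtains i j where "i \<noteq> j" "a = mk_edge i j"
proof -
  have "card (ends a) = 2" using ends[of a] by simp
  then obtain i j where "i \<noteq> j" "ends a = {i, j}" by (auto simp: card_2_iff)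
  then show ?thesis using that by (metis ends_inverse mk_edge_def)
qed

lemma card_edge: "CARD('n::card2 edge) = CARD('n) * (CARD('n) - 1) div 2"
proof -
  have "CARD('n edge) = card {A :: 'n set. card A = 2}"
    using type_definition.card[OF type_definition_edge] .
  also have "\<dots> = CARD('n) choose 2"
    using n_subsets[of "UNIV :: 'n set" 2] by simp
  finally show ?thesis by (simp add: choose_two)
qed

definition sqdist_vec :: "('n::card2 \<Rightarrow> real ^ 'p) \<Rightarrow> real ^ ('n edge)" where
  "sqdist_vec x = (\<chi> a. THE r. \<exists>i j. i \<noteq> j \<and> a = mk_edge i j \<and> r = (norm (x i - x j))\<^sup>2)"

lemma sqdist_vec_nth:
  assumes "i \<noteq> j"
  shows "sqdist_vec x $ mk_edge i j = (norm (x i - x j))\<^sup>2"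
  unfolding sqdist_vec_def vec_lambda_beta
proof (rule the_equality)
  show "\<exists>k l. k \<noteq> l \<and> mk_edge i j = mk_edge k l \<and> (norm (x i - x j))\<^sup>2 = (norm (x k - x l))\<^sup>2"
    using assms by blast
  show "r = (norm (x i - x j))\<^sup>2"
    if "\<exists>k l. k \<noteq> l \<and> mk_edge i j = mk_edge k l \<and> r = (norm (x k - x l))\<^sup>2" for r
    using that assms by (auto simp: mk_edge_eq_iff doubleton_eq_iff norm_minus_commute)
qed

definition degree_matrix :: "real ^ ('n::card2 edge) ^ ('n::card2)" where
  "degree_matrix = (\<chi> i a. if i \<in> ends a then 1 else 0)"

lemma degree_matrix_mult_nth:
  "(degree_matrix *v w) $ i = (\<Sum>j | j \<noteq> i. w $ mk_edge i j)"
proof -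
  have "bij_betw (mk_edge i) {j. j \<noteq> i} {a. i \<in> ends a}"
    unfolding bij_betw_def
  proof
    show "inj_on (mk_edge i) {j. j \<noteq> i}"
      by (auto simp: inj_on_def mk_edge_eq_iff doubleton_eq_iff)
    show "mk_edge i ` {j. j \<noteq> i} = {a. i \<in> ends a}"
    proof (intro set_eqI iffI)
      fix a assume "a \<in> {a. i \<in> ends a}"
      then show "a \<in> mk_edge i ` {j. j \<noteq> i}"
        by (cases a rule: edge_cases) (auto simp: ends_mk_edge mk_edge_commute)
    qed (auto simp: ends_mk_edge)
  qed
  then have "(\<Sum>j | j \<noteq> i. w $ mk_edge i j) = (\<Sum>a | i \<in> ends a. w $ a)"
    by (rule sum.reindex_bij_betw)
  also have "\<dots> = (degree_matrix *v w) $ i"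
    by (simp add: degree_matrix_def matrix_vector_mult_def sum.If_cases if_distrib[of "\<lambda>c. c * _"]
        cong: if_cong)
  finally show ?thesis ..
qed

definition primal_f :: "real \<Rightarrow> real ^ ('n::card2 edge) \<Rightarrow> real ^ ('n edge) \<Rightarrow> ereal" where
  "primal_f \<beta> e w =
     (if \<forall>a. 0 \<le> w $ a then 0 else \<infinity>) + ereal (2 * (w \<bullet> e) + \<beta> * (norm w)\<^sup>2)"

definition primal_g :: "real \<Rightarrow> real ^ 'n \<Rightarrow> ereal" where
  "primal_g \<alpha> d = (if \<forall>i. 0 < d $ i then ereal (- \<alpha> * (\<Sum>i\<in>UNIV. ln (d $ i))) else \<infinity>)"

(* The supremum in dual_F is attained, so it is the maximum. *)
definition dual_F :: "real \<Rightarrow> real ^ ('n::card2 edge) \<Rightarrow> real ^ ('n::card2) \<Rightarrow> ereal" where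
  "dual_F \<beta> e lam =
     (SUP w. ereal ((transpose degree_matrix *v lam) \<bullet> w) - primal_f \<beta> e w)"

definition dual_G :: "real \<Rightarrow> real ^ 'n \<Rightarrow> ereal" where
  "dual_G \<alpha> lam = (SUP d. ereal ((- lam) \<bullet> d) - primal_g \<alpha> d)"

definition dual_obj :: "real \<Rightarrow> real \<Rightarrow> real ^ ('n::card2 edge) \<Rightarrow> real ^ ('n::card2) \<Rightarrow> ereal" where
  "dual_obj \<alpha> \<beta> e lam = dual_F \<beta> e lam + dual_G \<alpha> lam"

definition thresholded :: "real \<Rightarrow> real ^ ('n::card2 edge) \<Rightarrow> real ^ ('n::card2) \<Rightarrow> real ^ ('n edge)" where
  "thresholded \<beta> e v =
     (\<chi> a. max 0 ((transpose degree_matrix *v v - 2 *\<^sub>R e) $ a / (2 * \<beta>)))"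

end

theory Submission
  imports Defs
begin

text \<open>
  The primal error is controlled by the dual gap. Since \<open>f\<close> is \<open>2\<beta>\<close>-strongly convex, every \<open>\<lambda>\<close>
  and every primal feasible \<open>w\<close> satisfy
  \<open>\<beta> \<parallel>w\<^sub>\<lambda> - w\<parallel>\<^sup>2 \<le> \<phi>(\<lambda>) + f(w) + g(S w)\<close>, where \<open>w\<^sub>\<lambda>\<close> is the maximizer defining \<open>F(\<lambda>)\<close>.
  A minimizer \<open>\<lambda>\<^sup>*\<close> of \<open>\<phi>\<close> is a fixed point of the proximal gradient step, so
  \<open>S w\<^sub>\<lambda> = \<alpha>/\<lambda>\<close> at \<open>\<lambda> = \<lambda>\<^sup>*\<close>; this closes the duality gap and gives
  \<open>f(w\<^sup>*) + g(S w\<^sup>*) \<le> -\<phi>(\<lambda>\<^sup>*)\<close>. It remains to bound \<open>\<phi>(\<lambda>\<^sub>k) - \<phi>(\<lambda>\<^sup>*)\<close>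
  by \<open>2L \<parallel>\<lambda>\<^sub>0 - \<lambda>\<^sup>*\<parallel>\<^sup>2/(k+1)\<^sup>2\<close>, which is the FISTA estimate:
  \<open>F\<close> has an \<open>L\<close>-Lipschitz gradient because \<open>\<parallel>S\<parallel>\<^sup>2 \<le> 2(N-1)\<close>.
\<close>

section \<open>Accelerated proximal gradient descent\<close>

text \<open>Each step adds at least 1/2, because the square root of 1 + 4 t^2 is at least 2
  t.\<close>

lemma fista_t_ge:
  fixes t :: "nat \<Rightarrow> real"
  assumes "t 1 = 1" and "\<And>k. k \<ge> 1 \<Longrightarrow> t (k + 1) = (1 + sqrt (1 + 4 * (t k)\<^sup>2)) / 2" and "k \<ge> 1"
  shows "(real k + 1) / 2 \<le> t k"
  using \<open>k \<ge> 1\<close>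
proof (induction k rule: dec_induct)
  case base
  then show ?case using assms(1) by simp
next
  case (step k)
  have "2 * t k \<le> sqrt (1 + 4 * (t k)\<^sup>2)"
    by (rule real_le_rsqrt) (simp add: power_mult_distrib)
  then show ?case using step assms(2)[of k] by simp
qed

text \<open>The starting point \<open>lam 0\<close> need not lie in \<open>P\<close>, because its weight \<open>t 1 - 1\<close> vanishes.\<close>
lemma fista_energy:
  fixes \<Phi> :: "'a::real_inner \<Rightarrow> real" and lam omega :: "nat \<Rightarrow> 'a" and t :: "nat \<Rightarrow> real"
  assumes descent: "\<And>k y. k \<ge> 1 \<Longrightarrow> y \<in> P \<Longrightarrow>
      \<Phi> (lam k) + c * (norm (y - lam k))\<^sup>2 \<le> \<Phi> y + c * (norm (y - omega k))\<^sup>2"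
    and P: "\<And>k. k \<ge> 1 \<Longrightarrow> lam k \<in> P" "z \<in> P"
    and omega_1: "omega 1 = lam 0" and t_1: "t 1 = 1"
    and t: "\<And>k. k \<ge> 1 \<Longrightarrow> t (k + 1) = (1 + sqrt (1 + 4 * (t k)\<^sup>2)) / 2"
    and omega: "\<And>k. k \<ge> 1 \<Longrightarrow>
      omega (k + 1) = lam k + ((t k - 1) / t (k + 1)) *\<^sub>R (lam k - lam (k - 1))"
    and "k \<ge> 1"
  shows "(t k)\<^sup>2 * (\<Phi> (lam k) - \<Phi> z)
      + c * (norm (t k *\<^sub>R lam k - (t k - 1) *\<^sub>R lam (k - 1) - z))\<^sup>2
    \<le> c * (norm (lam 0 - z))\<^sup>2"
  using \<open>k \<ge> 1\<close>
proof (induction k rule: dec_induct)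
  case base
  then show ?case using descent[of 1 z] P omega_1 t_1 by (simp add: norm_minus_commute)
next
  case (step k)
  define T where "T = t (k + 1)"
  define a where "a = lam k"
  define p where "p = lam (k + 1)"
  define y where "y = omega (k + 1)"
  \<comment> \<open>\<open>T\<close> is the positive root of T^2 - T = (t k)^2, so the weights of
    two consecutive energies match.\<close>
  have T: "1 \<le> T" and T2: "T\<^sup>2 - T = (t k)\<^sup>2"
  proof -
    show "1 \<le> T"
      using fista_t_ge[OF t_1 t, of "k + 1"] step.hyps by (simp add: T_def)
    have "2 * T - 1 = sqrt (1 + 4 * (t k)\<^sup>2)"
      using t[of k] step.hyps by (simp add: T_def)
    then have "(2 * T - 1)\<^sup>2 = 1 + 4 * (t k)\<^sup>2" by simp
    then show "T\<^sup>2 - T = (t k)\<^sup>2" by (simp add: power2_eq_square algebra_simps)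
  qed
  \<comment> \<open>The momentum coefficient is the one for which the auxiliary point formed with
    \<open>y\<close> is the auxiliary point of step \<open>k\<close>; this lets the energies
    telescope.\<close>
  have Ty: "T *\<^sub>R y - (T - 1) *\<^sub>R a - z = t k *\<^sub>R lam k - (t k - 1) *\<^sub>R lam (k - 1) - z"
  proof -
    have "T *\<^sub>R y = T *\<^sub>R lam k + (t k - 1) *\<^sub>R (lam k - lam (k - 1))"
      using omega[of k] step.hyps T by (simp add: T_def y_def scaleR_add_right)
    then show ?thesis by (simp add: a_def algebra_simps)
  qed
  \<comment> \<open>Descent is applied at the previous iterate \<open>a\<close> with weight T^2 - T
    and at \<open>z\<close> with weight T; both weights are nonnegative since T is at least
    1.\<close>
  have "(T\<^sup>2 - T) * (\<Phi> p + c * (norm (a - p))\<^sup>2) \<le> (T\<^sup>2 - T) * (\<Phi> a + c * (norm (a - y))\<^sup>2)"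
    using descent[of "k + 1" a] P step.hyps
    by (intro mult_left_mono) (auto simp: T2 p_def y_def a_def)
  moreover have "T * (\<Phi> p + c * (norm (z - p))\<^sup>2) \<le> T * (\<Phi> z + c * (norm (z - y))\<^sup>2)"
    using descent[of "k + 1" z] P T by (intro mult_left_mono) (auto simp: p_def y_def)
  \<comment> \<open>Only the first two terms on the right depend on \<open>v\<close>, so subtracting
    the cases \<open>p\<close> and \<open>y\<close> gives exactly the distances in the two weighted
    inequalities.\<close>
  moreover have "(norm (T *\<^sub>R v - (T - 1) *\<^sub>R a - z))\<^sup>2
      = (T\<^sup>2 - T) * (norm (a - v))\<^sup>2 + T * (norm (z - v))\<^sup>2
        + ((T - 1)\<^sup>2 - (T\<^sup>2 - T)) * (norm a)\<^sup>2 + (1 - T) * (norm z)\<^sup>2 + 2 * (T - 1) * (a \<bullet> z)" for v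
    by (simp add: power2_norm_eq_inner inner_diff_left inner_diff_right inner_commute)
      (simp add: algebra_simps power2_eq_square)
  from this[of p] this[of y]
  have "(norm (T *\<^sub>R p - (T - 1) *\<^sub>R a - z))\<^sup>2 - (norm (T *\<^sub>R y - (T - 1) *\<^sub>R a - z))\<^sup>2
      = (T\<^sup>2 - T) * (norm (a - p))\<^sup>2 + T * (norm (z - p))\<^sup>2
        - (T\<^sup>2 - T) * (norm (a - y))\<^sup>2 - T * (norm (z - y))\<^sup>2" by simp
  then have "c * (norm (T *\<^sub>R p - (T - 1) *\<^sub>R a - z))\<^sup>2
      - c * (norm (T *\<^sub>R y - (T - 1) *\<^sub>R a - z))\<^sup>2
      = (T\<^sup>2 - T) * (c * (norm (a - p))\<^sup>2) + T * (c * (norm (z - p))\<^sup>2)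
        - (T\<^sup>2 - T) * (c * (norm (a - y))\<^sup>2) - T * (c * (norm (z - y))\<^sup>2)"
    by (simp only: right_diff_distrib[symmetric]) (simp only: algebra_simps)
  ultimately have "T\<^sup>2 * (\<Phi> p - \<Phi> z) + c * (norm (T *\<^sub>R p - (T - 1) *\<^sub>R a - z))\<^sup>2
      \<le> (T\<^sup>2 - T) * (\<Phi> a - \<Phi> z) + c * (norm (T *\<^sub>R y - (T - 1) *\<^sub>R a - z))\<^sup>2"
    by (simp add: algebra_simps)
  then show ?case
    using step.IH unfolding Ty T2 by (simp add: T_def p_def a_def)
qed

section \<open>The smooth part of the dual\<close>

text \<open>An edge has two ends, so squaring its entry costs a factor 2 by Cauchy-Schwarz; a node
  lies on N - 1 edges, so the square of its entry is counted N - 1 times.\<close>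

lemma degree_matrix_transpose_bound:
  fixes z :: "real ^ 'n::card2"
  shows "(norm (transpose degree_matrix *v z))\<^sup>2 \<le> 2 * (real CARD('n) - 1) * (norm z)\<^sup>2"
proof -
  let ?D = "degree_matrix :: real ^ ('n::card2) edge ^ ('n::card2)"
  have D: "?D $ i $ a = (if i \<in> ends a then 1 else 0)" for i a
    by (simp add: degree_matrix_def)
  have "((transpose ?D *v z) $ a)\<^sup>2 \<le> 2 * (\<Sum>i\<in>UNIV. ?D $ i $ a * (z $ i)\<^sup>2)" for a
  proof -
    have "(transpose ?D *v z) $ a = (\<Sum>i\<in>ends a. z $ i)"
      by (simp add: matrix_vector_mult_def transpose_def D sum.If_cases
          if_distrib[of "\<lambda>c. c * _"] cong: if_cong)
    moreover have "(\<Sum>i\<in>UNIV. ?D $ i $ a * (z $ i)\<^sup>2) = (\<Sum>i\<in>ends a. (z $ i)\<^sup>2)"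
      by (simp add: D sum.If_cases if_distrib[of "\<lambda>c. c * _"] cong: if_cong)
    moreover have "card (ends a) = 2" using ends[of a] by simp
    ultimately show ?thesis
      using sum_squared_le_sum_of_squares[of "\<lambda>i. z $ i" "ends a"] by (simp add: mult.commute)
  qed
  then have "(norm (transpose ?D *v z))\<^sup>2 \<le> (\<Sum>a\<in>UNIV. 2 * (\<Sum>i\<in>UNIV. ?D $ i $ a * (z $ i)\<^sup>2))"
    unfolding power2_norm_eq_inner inner_vec_def by (intro sum_mono) (simp add: power2_eq_square)
  \<comment> \<open>Exchanging the sums leaves the row sums of \<open>?D\<close>, which are the
    nodal degrees for unit edge weights.\<close>
  also have "\<dots> = 2 * (\<Sum>i\<in>UNIV. (z $ i)\<^sup>2 * (?D *v 1) $ i)"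
    unfolding sum_distrib_left[symmetric]
    by (subst sum.swap) (simp add: matrix_vector_mult_def sum_distrib_right[symmetric] mult.commute)
  also have "\<dots> = 2 * (\<Sum>i\<in>UNIV. (z $ i)\<^sup>2 * (real CARD('n) - 1))"
  proof -
    have "{j. j \<noteq> i} = UNIV - {i}" for i :: 'n by auto
    then show ?thesis
      using two_le_card[where 'a = 'n]
      by (simp add: degree_matrix_mult_nth card_Diff_singleton of_nat_diff)
  qed
  also have "\<dots> = 2 * (real CARD('n) - 1) * (norm z)\<^sup>2"
    unfolding power2_norm_eq_inner inner_vec_def
    by (simp add: sum_distrib_right[symmetric] power2_eq_square)
  finally show ?thesis .
qed

lemma thresholded_nth:
  "thresholded \<beta> e v $ a = max 0 ((transpose degree_matrix *v v - 2 *\<^sub>R e) $ a / (2 * \<beta>))"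
  by (simp add: thresholded_def)

lemma thresholded_nonneg: "0 \<le> thresholded \<beta> e v $ a"
  by (simp add: thresholded_nth)

text \<open>Complementarity: an entry of the maximizer is either 0 or the unconstrained maximizer,
  so the linear term is twice the quadratic one.\<close>

lemma thresholded_value:
  assumes "\<beta> > 0"
  shows "(transpose degree_matrix *v v) \<bullet> thresholded \<beta> e v
      - (2 * (thresholded \<beta> e v \<bullet> e) + \<beta> * (norm (thresholded \<beta> e v))\<^sup>2)
    = \<beta> * (norm (thresholded \<beta> e v))\<^sup>2"
proof -
  let ?c = "transpose degree_matrix *v v - 2 *\<^sub>R e" and ?w = "thresholded \<beta> e v"
  have "?c $ a * ?w $ a = 2 * \<beta> * (?w $ a * ?w $ a)" for a
    using assms unfolding thresholded_nth by (auto simp: max_def field_simps)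
  then have "?c \<bullet> ?w = 2 * \<beta> * (?w \<bullet> ?w)"
    by (simp only: inner_vec_def inner_real_def sum_distrib_left)
  then show ?thesis
    by (simp add: power2_norm_eq_inner inner_diff_left inner_commute[of _ e])
qed

text \<open>Thresholding only raises entries; pairing this with a nonnegative \<open>w\<close> and
  completing the square leaves the quadratic term. The inequality serves for the value of F, the
  uniqueness of its maximizer, the subgradient inequality and the gap bound.\<close>

lemma thresholded_strongly_maximal:
  assumes "\<beta> > 0" and "\<forall>a. 0 \<le> w $ a"
  shows "(transpose degree_matrix *v v) \<bullet> w - (2 * (w \<bullet> e) + \<beta> * (norm w)\<^sup>2)
    \<le> \<beta> * (norm (thresholded \<beta> e v))\<^sup>2 - \<beta> * (norm (w - thresholded \<beta> e v))\<^sup>2"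
proof -
  let ?c = "transpose degree_matrix *v v - 2 *\<^sub>R e" and ?w = "thresholded \<beta> e v"
  have "?c $ a \<le> 2 * \<beta> * ?w $ a" for a
    using assms(1) unfolding thresholded_nth by (auto simp: max_def field_simps)
  then have "?c $ a * w $ a \<le> 2 * \<beta> * (?w $ a * w $ a)" for a
    using assms(2) mult_right_mono[of "?c $ a" "2 * \<beta> * ?w $ a" "w $ a"] by (simp add: mult.assoc)
  then have "?c \<bullet> w \<le> 2 * \<beta> * (?w \<bullet> w)"
    unfolding inner_vec_def inner_real_def sum_distrib_left by (intro sum_mono)
  then show ?thesis
    by (simp add: power2_norm_eq_inner inner_diff_left inner_diff_right inner_commute algebra_simps)
qed

lemma dual_F_eq:
  assumes "\<beta> > 0"
  shows "dual_F \<beta> e v = ereal (\<beta> * (norm (thresholded \<beta> e v))\<^sup>2)"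
  unfolding dual_F_def
proof (intro antisym SUP_least)
  fix w
  show "ereal ((transpose degree_matrix *v v) \<bullet> w) - primal_f \<beta> e w
      \<le> ereal (\<beta> * (norm (thresholded \<beta> e v))\<^sup>2)"
  proof (cases "\<forall>a. 0 \<le> w $ a")
    case True
    have "0 \<le> \<beta> * (norm (w - thresholded \<beta> e v))\<^sup>2" using assms by simp
    with True show ?thesis
      using thresholded_strongly_maximal[OF assms True, of v e] by (simp add: primal_f_def)
  qed (auto simp: primal_f_def)
next
  show "ereal (\<beta> * (norm (thresholded \<beta> e v))\<^sup>2)
      \<le> (SUP w. ereal ((transpose degree_matrix *v v) \<bullet> w) - primal_f \<beta> e w)"
    by (rule SUP_upper2[of "thresholded \<beta> e v"])
      (use thresholded_value[OF assms, of v e] in \<open>simp_all add: primal_f_def thresholded_nonneg\<close>)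
qed

lemma arg_max_primal_f:
  assumes "\<beta> > 0"
  shows "{w. is_arg_max (\<lambda>w. ereal ((transpose degree_matrix *v v) \<bullet> w) - primal_f \<beta> e w) (\<lambda>_. True) w}
    = {thresholded \<beta> e v}"
proof -
  let ?q = "\<lambda>w. ereal ((transpose degree_matrix *v v) \<bullet> w) - primal_f \<beta> e w"
  let ?w = "thresholded \<beta> e v"
  have "?q ?w = ereal (\<beta> * (norm ?w)\<^sup>2)"
    using thresholded_value[OF assms, of v e] by (simp add: primal_f_def thresholded_nonneg)
  moreover have "?q w < ereal (\<beta> * (norm ?w)\<^sup>2)" if "w \<noteq> ?w" for w
  proof (cases "\<forall>a. 0 \<le> w $ a")
    case True
    have "0 < \<beta> * (norm (w - ?w))\<^sup>2" using assms that by simp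
    with True show ?thesis
      using thresholded_strongly_maximal[OF assms True, of v e] by (simp add: primal_f_def)
  qed (auto simp: primal_f_def)
  ultimately have less: "?q w < ?q ?w" if "w \<noteq> ?w" for w
    using that by simp
  then have "is_arg_max ?q (\<lambda>_. True) w \<longleftrightarrow> w = ?w" for w
    unfolding is_arg_max_def by (metis less_asym')
  then show ?thesis by auto
qed

text \<open>The maximizer at \<open>y\<close> competes in the maximum that defines F at
  \<open>z\<close>, so its degree vector is a subgradient of F at \<open>y\<close>.\<close>

lemma dual_F_convex:
  assumes "\<beta> > 0"
  shows "\<beta> * (norm (thresholded \<beta> e y))\<^sup>2 + (degree_matrix *v thresholded \<beta> e y) \<bullet> (z - y)
    \<le> \<beta> * (norm (thresholded \<beta> e z))\<^sup>2"
proof -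
  let ?w = "thresholded \<beta> e y"
  have "(transpose degree_matrix *v z) \<bullet> ?w - (2 * (?w \<bullet> e) + \<beta> * (norm ?w)\<^sup>2)
      \<le> \<beta> * (norm (thresholded \<beta> e z))\<^sup>2 - \<beta> * (norm (?w - thresholded \<beta> e z))\<^sup>2"
    by (rule thresholded_strongly_maximal) (simp_all add: assms thresholded_nonneg)
  moreover have "0 \<le> \<beta> * (norm (?w - thresholded \<beta> e z))\<^sup>2" using assms by simp
  ultimately show ?thesis
    using thresholded_value[OF assms, of y e]
    by (simp add: dot_lmul_matrix inner_diff_right inner_commute[of "_ *v _"])
qed

text \<open>The quadratic upper bound comes from comparing squared entries, without derivatives; its
  constant is 2(N - 1)/(4 \<beta>) = L/2.\<close>

lemma dual_F_smooth:
  fixes y z :: "real ^ 'n::card2"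
  assumes "\<beta> > 0"
  shows "\<beta> * (norm (thresholded \<beta> e z))\<^sup>2
    \<le> \<beta> * (norm (thresholded \<beta> e y))\<^sup>2 + (degree_matrix *v thresholded \<beta> e y) \<bullet> (z - y)
      + (real CARD('n) - 1) / \<beta> / 2 * (norm (z - y))\<^sup>2"
proof -
  let ?A = "transpose degree_matrix :: real ^ ('n::card2) ^ ('n::card2) edge"
  let ?wy = "thresholded \<beta> e y" and ?wz = "thresholded \<beta> e z"
  define h where "h = ?A *v (z - y)"
  \<comment> \<open>For real s and r, max(0, s + r) is at most the absolute value of max(0, s) +
    r.\<close>
  have "(?wz $ a)\<^sup>2 \<le> (?wy $ a + h $ a / (2 * \<beta>))\<^sup>2" for a
  proof -
    have "(?A *v z - 2 *\<^sub>R e) $ a / (2 * \<beta>)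
        = (?A *v y - 2 *\<^sub>R e) $ a / (2 * \<beta>) + h $ a / (2 * \<beta>)"
      by (simp add: h_def matrix_vector_mult_diff_distrib add_divide_distrib[symmetric])
    then have "\<bar>?wz $ a\<bar> \<le> \<bar>?wy $ a + h $ a / (2 * \<beta>)\<bar>"
      unfolding thresholded_nth by linarith
    then show ?thesis by (simp only: abs_le_square_iff)
  qed
  then have "(norm ?wz)\<^sup>2 \<le> (norm (?wy + (1 / (2 * \<beta>)) *\<^sub>R h))\<^sup>2"
    unfolding power2_norm_eq_inner inner_vec_def by (intro sum_mono) (simp add: power2_eq_square)
  then have "\<beta> * (norm ?wz)\<^sup>2 \<le> \<beta> * (norm (?wy + (1 / (2 * \<beta>)) *\<^sub>R h))\<^sup>2"
    using assms by simp
  also have "\<dots> = \<beta> * (norm ?wy)\<^sup>2 + h \<bullet> ?wy + (norm h)\<^sup>2 / (4 * \<beta>)"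
    using assms by (simp add: power2_norm_eq_inner inner_add_left inner_add_right inner_commute field_simps)
  also have "h \<bullet> ?wy = (degree_matrix *v ?wy) \<bullet> (z - y)"
    by (simp add: h_def dot_lmul_matrix inner_commute[of "_ *v _"])
  also have "(norm h)\<^sup>2 / (4 * \<beta>) \<le> 2 * (real CARD('n) - 1) * (norm (z - y))\<^sup>2 / (4 * \<beta>)"
    unfolding h_def using assms by (intro divide_right_mono degree_matrix_transpose_bound) simp
  also have "2 * (real CARD('n) - 1) * (norm (z - y))\<^sup>2 / (4 * \<beta>)
      = (real CARD('n) - 1) / \<beta> / 2 * (norm (z - y))\<^sup>2"
    using assms by (simp add: field_simps)
  finally show ?thesis by simp
qed

section \<open>The barrier part of the dual\<close>

text \<open>This is ln s \<le> s - 1 at s = v d / \<alpha>, with equality at d = \<alpha> /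
  v.\<close>

lemma log_barrier_conjugate_le:
  fixes d v \<alpha> :: real
  assumes "\<alpha> > 0" "v > 0" "d > 0"
  shows "- (v * d) + \<alpha> * ln d \<le> \<alpha> * ln (\<alpha> / v) - \<alpha>"
proof -
  have "\<alpha> * ln (v * d / \<alpha>) \<le> \<alpha> * (v * d / \<alpha> - 1)"
    using assms by (intro mult_left_mono ln_le_minus_one) simp_all
  then show ?thesis
    using assms by (simp add: ln_mult ln_div algebra_simps)
qed

text \<open>The real value of \<open>dual_G\<close>, meaningful only on the positive
  orthant.\<close>

definition barrier_dual :: "real \<Rightarrow> real ^ 'n \<Rightarrow> real" where
  "barrier_dual \<alpha> v = (\<Sum>i\<in>UNIV. \<alpha> * ln (\<alpha> / v $ i) - \<alpha>)"

lemma barrier_dual_ge: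
  assumes "\<alpha> > 0" "\<forall>i. 0 < v $ i" "\<forall>i. 0 < d $ i"
  shows "- (v \<bullet> d) + \<alpha> * (\<Sum>i\<in>UNIV. ln (d $ i)) \<le> barrier_dual \<alpha> v"
proof -
  have "(\<Sum>i\<in>UNIV. - (v $ i * d $ i) + \<alpha> * ln (d $ i)) \<le> barrier_dual \<alpha> v"
    unfolding barrier_dual_def using assms by (intro sum_mono log_barrier_conjugate_le) auto
  then show ?thesis
    by (simp add: inner_vec_def sum_subtractf sum_distrib_left)
qed

lemma barrier_dual_eq:
  assumes "\<alpha> > 0" "\<forall>i. 0 < v $ i" "\<forall>i. d $ i = \<alpha> / v $ i"
  shows "- (v \<bullet> d) + \<alpha> * (\<Sum>i\<in>UNIV. ln (d $ i)) = barrier_dual \<alpha> v"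
proof -
  have "v $ i * d $ i = \<alpha>" for i
    using assms(2)[rule_format, of i] assms(3) by simp
  then show ?thesis
    using assms(3) by (simp add: barrier_dual_def inner_vec_def sum_subtractf sum_distrib_left)
qed

text \<open>As in \<open>dual_F_convex\<close>, the maximizer \<open>d\<close> at \<open>p\<close>
  competes at \<open>z\<close>, so -d is a subgradient.\<close>

lemma barrier_dual_convex:
  assumes "\<alpha> > 0" "\<forall>i. 0 < p $ i" "\<forall>i. 0 < z $ i" "\<forall>i. d $ i = \<alpha> / p $ i"
  shows "barrier_dual \<alpha> p - d \<bullet> (z - p) \<le> barrier_dual \<alpha> z"
proof -
  have "\<forall>i. 0 < d $ i" using assms by simp
  from barrier_dual_ge[OF assms(1,3) this] barrier_dual_eq[OF assms(1,2,4)]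
  show ?thesis by (simp add: inner_diff_right inner_commute)
qed

lemma dual_G_eq:
  fixes v :: "real ^ 'n"
  assumes "\<alpha> > 0" "\<forall>i. 0 < v $ i"
  shows "dual_G \<alpha> v = ereal (barrier_dual \<alpha> v)"
  unfolding dual_G_def
proof (intro antisym SUP_least)
  fix d :: "real ^ 'n"
  show "ereal ((- v) \<bullet> d) - primal_g \<alpha> d \<le> ereal (barrier_dual \<alpha> v)"
    using barrier_dual_ge[OF assms, of d] by (simp add: primal_g_def)
next
  let ?d = "\<chi> i. \<alpha> / v $ i"
  show "ereal (barrier_dual \<alpha> v) \<le> (SUP d. ereal ((- v) \<bullet> d) - primal_g \<alpha> d)"
    by (rule SUP_upper2[of ?d])
      (use barrier_dual_eq[OF assms, of ?d] assms in \<open>simp_all add: primal_g_def\<close>)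
qed

text \<open>Raising the i-th entry of \<open>d\<close> never lowers the linear term, while the
  logarithm grows without bound.\<close>

lemma dual_G_eq_infinity:
  fixes v :: "real ^ 'n"
  assumes "\<alpha> > 0" "v $ i \<le> 0"
  shows "dual_G \<alpha> v = \<infinity>"
proof (rule ereal_top)
  fix B
  define C where "C = (\<Sum>j\<in>UNIV - {i}. v $ j)"
  \<comment> \<open>Chosen so that \<alpha> ln m = B + C; the C pays for the entries of
    \<open>d\<close> fixed at 1.\<close>
  define m where "m = exp ((B + C) / \<alpha>)"
  define d :: "real ^ 'n" where "d = (\<chi> j. if j = i then m else 1)"
  have "v \<bullet> d = v $ i * m + C"
    by (simp add: inner_vec_def d_def C_def sum.remove[of UNIV i])
  moreover have "v $ i * m \<le> 0"
    using assms by (simp add: m_def mult_le_0_iff)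
  moreover have "\<alpha> * (\<Sum>j\<in>UNIV. ln (d $ j)) = B + C"
    using assms(1) by (simp add: d_def sum.remove[of UNIV i] m_def)
  moreover have "\<forall>j. 0 < d $ j" by (simp add: d_def m_def)
  ultimately show "ereal B \<le> dual_G \<alpha> v"
    unfolding dual_G_def by (intro SUP_upper2[of d]) (simp_all add: primal_g_def)
qed

section \<open>The dual problem\<close>

definition dual_fun :: "real \<Rightarrow> real \<Rightarrow> real ^ ('n::card2 edge) \<Rightarrow> real ^ ('n::card2) \<Rightarrow> real" where
  "dual_fun \<alpha> \<beta> e v = \<beta> * (norm (thresholded \<beta> e v))\<^sup>2 + barrier_dual \<alpha> v"

lemma dual_obj_eq:
  assumes "\<alpha> > 0" "\<beta> > 0" "\<forall>i. 0 < v $ i"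
  shows "dual_obj \<alpha> \<beta> e v = ereal (dual_fun \<alpha> \<beta> e v)"
  using assms by (simp add: dual_obj_def dual_fun_def dual_F_eq dual_G_eq)

text \<open>The dual objective is infinite off the positive orthant and finite at the all-ones
  vector.\<close>

lemma dual_obj_minimizer_pos:
  fixes v :: "real ^ 'n::card2"
  assumes "\<alpha> > 0" "\<beta> > 0" "is_arg_min (dual_obj \<alpha> \<beta> e) (\<lambda>_. True) v"
  shows "0 < v $ i"
proof (rule ccontr)
  assume "\<not> 0 < v $ i"
  then have "dual_obj \<alpha> \<beta> e v = \<infinity>"
    using assms by (simp add: dual_obj_def dual_F_eq dual_G_eq_infinity[of \<alpha> v i])
  moreover have "dual_obj \<alpha> \<beta> e 1 < \<infinity>"
    using assms by (simp add: dual_obj_eq)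
  ultimately show False
    using assms(3) by (simp add: is_arg_min_def)
qed

section \<open>The proximal gradient step and stationarity\<close>

text \<open>\<open>u\<close> is the positive root of u (u - a) = \<alpha> L.\<close>

lemma prox_log_barrier:
  fixes a L \<alpha> :: real
  assumes "\<alpha> > 0" "L > 0" and u: "u = 1 / 2 * (a + sqrt (a\<^sup>2 + 4 * \<alpha> * L))"
  shows "u > a" "u = \<alpha> / ((u - a) / L)"
proof -
  have "sqrt (a\<^sup>2) < sqrt (a\<^sup>2 + 4 * \<alpha> * L)"
    using assms by (intro real_sqrt_less_mono) simp
  then have "\<bar>a\<bar> < sqrt (a\<^sup>2 + 4 * \<alpha> * L)" by simp
  moreover have u2: "2 * u = a + sqrt (a\<^sup>2 + 4 * \<alpha> * L)" by (simp add: u)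
  ultimately show "u > a" by linarith
  have "(2 * u - a)\<^sup>2 = (sqrt (a\<^sup>2 + 4 * \<alpha> * L))\<^sup>2" using u2 by simp
  also have "\<dots> = a\<^sup>2 + 4 * \<alpha> * L"
    using assms(1,2) by simp
  finally have "(2 * u - a)\<^sup>2 = a\<^sup>2 + 4 * \<alpha> * L" .
  then have "u * (u - a) = \<alpha> * L" by (simp add: power2_eq_square algebra_simps)
  then show "u = \<alpha> / ((u - a) / L)"
    using \<open>u > a\<close> assms(2) by (simp add: field_simps)
qed

text \<open>The last two claims are the stationarity condition of the proximal subproblem. Here
  \<open>y\<close> is arbitrary: extrapolated points may leave the positive orthant, but
  \<open>p\<close> stays inside.\<close>

lemma prox_step_optimality:
  fixes y s u p :: "real ^ 'n"
  assumes "\<alpha> > 0" "L > 0"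
    and u: "\<And>i. u $ i = 1 / 2 * ((s - L *\<^sub>R y) $ i + sqrt (((s - L *\<^sub>R y) $ i)\<^sup>2 + 4 * \<alpha> * L))"
    and p: "p = y - inverse L *\<^sub>R (s - u)"
  shows "\<forall>i. 0 < p $ i" "\<forall>i. u $ i = \<alpha> / p $ i" "u = s + L *\<^sub>R (p - y)"
proof -
  have "p $ i = (u $ i - (s - L *\<^sub>R y) $ i) / L" for i
    using assms(2) by (simp add: p field_simps)
  then show "\<forall>i. 0 < p $ i" "\<forall>i. u $ i = \<alpha> / p $ i"
    using prox_log_barrier[OF assms(1,2) u] assms(2) by simp_all
  show "u = s + L *\<^sub>R (p - y)"
    using assms(2) by (simp add: p)
qed

text \<open>Three estimates are added: smoothness of F from \<open>y\<close> to \<open>p\<close>,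
  convexity of F from \<open>y\<close> to \<open>z\<close>, and convexity of the barrier from
  \<open>p\<close> to \<open>z\<close>. Stationarity turns the linear terms into an inner product,
  which the law of cosines absorbs.\<close>

lemma prox_step_descent:
  fixes y z :: "real ^ 'n::card2"
  assumes "\<alpha> > 0" "\<beta> > 0" and L: "L = (real CARD('n) - 1) / \<beta>"
    and p: "\<forall>i. 0 < p $ i" and z: "\<forall>i. 0 < z $ i"
    and u: "\<forall>i. u $ i = \<alpha> / p $ i" "u = degree_matrix *v thresholded \<beta> e y + L *\<^sub>R (p - y)"
  shows "dual_fun \<alpha> \<beta> e p + L / 2 * (norm (z - p))\<^sup>2
    \<le> dual_fun \<alpha> \<beta> e z + L / 2 * (norm (z - y))\<^sup>2"
proof -
  let ?s = "degree_matrix *v thresholded \<beta> e y"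
  have "L / 2 * (norm (p - y))\<^sup>2 + L / 2 * (norm (z - p))\<^sup>2 + L * ((p - y) \<bullet> (z - p))
      = L / 2 * (norm ((p - y) + (z - p)))\<^sup>2"
    by (simp only: power2_norm_eq_inner inner_add_left inner_add_right)
      (simp add: inner_commute algebra_simps)
  then have "L / 2 * (norm (p - y))\<^sup>2 + L / 2 * (norm (z - p))\<^sup>2
      = L / 2 * (norm (z - y))\<^sup>2 - L * ((p - y) \<bullet> (z - p))" by simp
  moreover have "u \<bullet> (z - p) = ?s \<bullet> (z - p) + L * ((p - y) \<bullet> (z - p))"
    by (simp add: u(2) inner_add_left)
  moreover have "?s \<bullet> (z - y) = ?s \<bullet> (z - p) + ?s \<bullet> (p - y)"
    by (simp add: inner_diff_right)
  ultimately show ?thesis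
    using dual_F_convex[OF assms(2), of e y z] dual_F_smooth[OF assms(2), of e p y]
      barrier_dual_convex[OF assms(1) p z u(1)]
    unfolding dual_fun_def L[symmetric] by linarith
qed

lemma dual_lipschitz_pos:
  assumes "\<beta> > 0"
  shows "(real CARD('n::card2) - 1) / \<beta> > 0"
  using two_le_card[where 'a = 'n] assms by simp

lemma dual_minimizer_stationary:
  fixes v :: "real ^ 'n::card2"
  assumes "\<alpha> > 0" "\<beta> > 0" and min: "is_arg_min (dual_obj \<alpha> \<beta> e) (\<lambda>_. True) v"
  shows "(degree_matrix *v thresholded \<beta> e v) $ i = \<alpha> / v $ i"
proof -
  define L where "L = (real CARD('n) - 1) / \<beta>"
  define s where "s = degree_matrix *v thresholded \<beta> e v"
  define u :: "real ^ 'n::card2" where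
    "u = (\<chi> i. 1 / 2 * ((s - L *\<^sub>R v) $ i + sqrt (((s - L *\<^sub>R v) $ i)\<^sup>2 + 4 * \<alpha> * L)))"
  define p where "p = v - inverse L *\<^sub>R (s - u)"
  have "L > 0" unfolding L_def using dual_lipschitz_pos assms(2) .
  have "u $ i = 1 / 2 * ((s - L *\<^sub>R v) $ i + sqrt (((s - L *\<^sub>R v) $ i)\<^sup>2 + 4 * \<alpha> * L))" for i
    by (simp add: u_def)
  note step = prox_step_optimality[OF assms(1) \<open>L > 0\<close> this p_def]
  have v: "\<forall>i. 0 < v $ i" using dual_obj_minimizer_pos[OF assms] by simp
  \<comment> \<open>With both \<open>y\<close> and \<open>z\<close> equal to \<open>v\<close>, the
    distance on the right vanishes; minimality of \<open>v\<close> then forces \<open>p\<close> to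
    equal \<open>v\<close>.\<close>
  have "dual_fun \<alpha> \<beta> e p + L / 2 * (norm (v - p))\<^sup>2 \<le> dual_fun \<alpha> \<beta> e v + L / 2 * (norm (v - v))\<^sup>2"
    by (rule prox_step_descent[OF assms(1,2) L_def step(1) v step(2) step(3)[unfolded s_def]])
  moreover have "dual_fun \<alpha> \<beta> e v \<le> dual_fun \<alpha> \<beta> e p"
    using min dual_obj_eq[OF assms(1,2) step(1)] dual_obj_eq[OF assms(1,2) v]
    by (metis is_arg_min_linorder ereal_less_eq(3))
  ultimately have "L * (norm (v - p))\<^sup>2 \<le> 0" by simp
  then have "p = v"
    using \<open>L > 0\<close> by (simp add: mult_le_0_iff)
  then show ?thesis using step(2,3) by (simp add: s_def)
qed

section \<open>The duality gap\<close>

text \<open>Weak duality with a quadratic remainder: the bounds for F at \<open>w\<close> and for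
  the barrier at its degree vector are added, and the bilinear terms cancel.\<close>

lemma dual_gap_ge:
  assumes "\<alpha> > 0" "\<beta> > 0" and v: "\<forall>i. 0 < v $ i"
    and w: "\<forall>a. 0 \<le> w $ a" "\<forall>i. 0 < (degree_matrix *v w) $ i"
  shows "\<beta> * (norm (thresholded \<beta> e v - w))\<^sup>2
    \<le> dual_fun \<alpha> \<beta> e v
      + (2 * (w \<bullet> e) + \<beta> * (norm w)\<^sup>2 - \<alpha> * (\<Sum>i\<in>UNIV. ln ((degree_matrix *v w) $ i)))"
  using thresholded_strongly_maximal[OF assms(2) w(1), of v e] barrier_dual_ge[OF assms(1) v w(2)]
  by (simp add: dual_fun_def dot_lmul_matrix norm_minus_commute)

text \<open>By stationarity both conjugate inequalities are equalities at the thresholded point, so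
  its primal value is minus the dual optimum, and \<open>w\<close> does no worse.\<close>

lemma primal_minimizer:
  fixes w :: "real ^ ('n::card2 edge)"
  assumes "\<alpha> > 0" "\<beta> > 0"
    and w: "is_arg_min (\<lambda>w. primal_f \<beta> e w + primal_g \<alpha> (degree_matrix *v w)) (\<lambda>_. True) w"
    and v: "is_arg_min (dual_obj \<alpha> \<beta> e) (\<lambda>_. True) v"
  shows "\<forall>a. 0 \<le> w $ a" "\<forall>i. 0 < (degree_matrix *v w) $ i"
    "2 * (w \<bullet> e) + \<beta> * (norm w)\<^sup>2 - \<alpha> * (\<Sum>i\<in>UNIV. ln ((degree_matrix *v w) $ i))
      \<le> - dual_fun \<alpha> \<beta> e v"
proof -
  let ?p = "\<lambda>w. primal_f \<beta> e w + primal_g \<alpha> (degree_matrix *v w)"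
  let ?w = "thresholded \<beta> e v"
  have vpos: "\<forall>i. 0 < v $ i" using dual_obj_minimizer_pos[OF assms(1,2) v] by simp
  have d: "\<forall>i. (degree_matrix *v ?w) $ i = \<alpha> / v $ i"
    using dual_minimizer_stationary[OF assms(1,2) v] by simp
  have "?p ?w = ereal (2 * (?w \<bullet> e) + \<beta> * (norm ?w)\<^sup>2
      - \<alpha> * (\<Sum>i\<in>UNIV. ln ((degree_matrix *v ?w) $ i)))"
    using vpos assms(1) by (simp add: primal_f_def primal_g_def thresholded_nonneg d)
  also have "\<dots> = ereal (- dual_fun \<alpha> \<beta> e v)"
    using thresholded_value[OF assms(2), of v e] barrier_dual_eq[OF assms(1) vpos d]
    by (simp add: dual_fun_def dot_lmul_matrix)
  finally have le: "?p w \<le> ereal (- dual_fun \<alpha> \<beta> e v)"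
    using w by (metis is_arg_min_linorder)
  \<comment> \<open>A finite upper bound on the primal value rules out the infinite branches of f
    and then g.\<close>
  show 1: "\<forall>a. 0 \<le> w $ a"
    using le by (rule contrapos_pp) (auto simp: primal_f_def primal_g_def)
  show 2: "\<forall>i. 0 < (degree_matrix *v w) $ i"
    using le by (rule contrapos_pp) (use 1 in \<open>auto simp: primal_f_def primal_g_def\<close>)
  show "2 * (w \<bullet> e) + \<beta> * (norm w)\<^sup>2 - \<alpha> * (\<Sum>i\<in>UNIV. ln ((degree_matrix *v w) $ i))
      \<le> - dual_fun \<alpha> \<beta> e v"
    using le 1 2 by (simp add: primal_f_def primal_g_def)
qed

theorem theorem2:
  fixes x :: "'n::card2 \<Rightarrow> real ^ 'p"
    and \<alpha> \<beta> L :: real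
    and e :: "real ^ ('n edge)"
    and S :: "real ^ ('n edge) ^ ('n::card2)"
    and w_star :: "real ^ ('n edge)"
    and lam_star :: "real ^ ('n::card2)"
    and wbar what :: "nat \<Rightarrow> real ^ ('n edge)"
    and u lam omega :: "nat \<Rightarrow> real ^ ('n::card2)"
    and t :: "nat \<Rightarrow> real"
  assumes "\<alpha> > 0" and "\<beta> > 0"
    and e: "e = sqdist_vec x"
    and S: "S = degree_matrix"
    and w_star: "is_arg_min (\<lambda>w. primal_f \<beta> e w + primal_g \<alpha> (S *v w)) (\<lambda>_. True) w_star"
    and lam_star: "is_arg_min (dual_obj \<alpha> \<beta> e) (\<lambda>_. True) lam_star"
    and L: "L = (real CARD('n) - 1) / \<beta>"
    and omega_1: "omega 1 = lam 0"
    and t_1: "t 1 = 1"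
    and wbar: "\<And>k. k \<ge> 1 \<Longrightarrow> wbar k = thresholded \<beta> e (omega k)"
    and u: "\<And>k i. k \<ge> 1 \<Longrightarrow>
      u k $ i = 1 / 2 * ((S *v wbar k - L *\<^sub>R omega k) $ i
                 + sqrt (((S *v wbar k - L *\<^sub>R omega k) $ i)\<^sup>2 + 4 * \<alpha> * L))"
    and lam: "\<And>k. k \<ge> 1 \<Longrightarrow> lam k = omega k - inverse L *\<^sub>R (S *v wbar k - u k)"
    and t: "\<And>k. k \<ge> 1 \<Longrightarrow> t (k + 1) = (1 + sqrt (1 + 4 * (t k)\<^sup>2)) / 2"
    and omega: "\<And>k. k \<ge> 1 \<Longrightarrow>
      omega (k + 1) = lam k + ((t k - 1) / t (k + 1)) *\<^sub>R (lam k - lam (k - 1))"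
    and what: "\<And>k. k \<ge> 1 \<Longrightarrow> what k = thresholded \<beta> e (lam k)"
  shows "\<forall>k\<ge>1.
      {w. is_arg_max (\<lambda>w. ereal ((transpose S *v lam k) \<bullet> w) - primal_f \<beta> e w) (\<lambda>_. True) w}
        = {what k} \<and>
      norm (what k - w_star)
        \<le> sqrt (2 * (real CARD('n) - 1)) * norm (lam 0 - lam_star) / (\<beta> * real k)"
proof (intro allI impI conjI)
  fix k :: nat
  assume "k \<ge> 1"
  show "{w. is_arg_max (\<lambda>w. ereal ((transpose S *v lam k) \<bullet> w) - primal_f \<beta> e w) (\<lambda>_. True) w}
      = {what k}"
    using arg_max_primal_f[OF \<open>\<beta> > 0\<close>] what[OF \<open>k \<ge> 1\<close>] by (simp add: S)
  let ?\<Phi> = "dual_fun \<alpha> \<beta> e" and ?R = "norm (lam 0 - lam_star)"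
  have Lpos: "L > 0" unfolding L using dual_lipschitz_pos \<open>\<beta> > 0\<close> .
  have step: "\<forall>i. 0 < lam k $ i" "\<forall>i. u k $ i = \<alpha> / lam k $ i"
      "u k = S *v wbar k + L *\<^sub>R (lam k - omega k)" if "k \<ge> 1" for k
    by (rule prox_step_optimality[OF \<open>\<alpha> > 0\<close> Lpos u[OF that] lam[OF that]])+
  have star: "\<forall>i. 0 < lam_star $ i"
    using dual_obj_minimizer_pos[OF \<open>\<alpha> > 0\<close> \<open>\<beta> > 0\<close> lam_star] by simp
  \<comment> \<open>Positivity is asked of \<open>y\<close> and holds for \<open>lam k\<close>, but
    \<open>omega k\<close> may be any point.\<close>
  have descent: "?\<Phi> (lam k) + L / 2 * (norm (y - lam k))\<^sup>2 \<le> ?\<Phi> y + L / 2 * (norm (y - omega k))\<^sup>2"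
    if "k \<ge> 1" "y \<in> {y. \<forall>i. 0 < y $ i}" for k y
    using prox_step_descent[OF \<open>\<alpha> > 0\<close> \<open>\<beta> > 0\<close> L step(1)[OF that(1)] _ step(2)[OF that(1)]]
      step(3)[OF that(1)] that(2) by (simp add: S wbar[OF that(1)])
  have "(t k)\<^sup>2 * (?\<Phi> (lam k) - ?\<Phi> lam_star)
      + L / 2 * (norm (t k *\<^sub>R lam k - (t k - 1) *\<^sub>R lam (k - 1) - lam_star))\<^sup>2 \<le> L / 2 * ?R\<^sup>2"
    by (rule fista_energy[where c = "L / 2" and P = "{y. \<forall>i. 0 < y $ i}", OF descent _ _ omega_1 t_1 t omega \<open>k \<ge> 1\<close>]) (use step(1) star in auto)
  moreover have "0 \<le> L / 2 * (norm (t k *\<^sub>R lam k - (t k - 1) *\<^sub>R lam (k - 1) - lam_star))\<^sup>2"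
    using Lpos by simp
  ultimately have gap: "(t k)\<^sup>2 * (?\<Phi> (lam k) - ?\<Phi> lam_star) \<le> L / 2 * ?R\<^sup>2"
    by linarith
  note opt = primal_minimizer[OF \<open>\<alpha> > 0\<close> \<open>\<beta> > 0\<close> w_star[unfolded S] lam_star]
  let ?D = "norm (what k - w_star)"
  have "\<beta> * ?D\<^sup>2 \<le> ?\<Phi> (lam k) - ?\<Phi> lam_star"
    using dual_gap_ge[OF \<open>\<alpha> > 0\<close> \<open>\<beta> > 0\<close> step(1)[OF \<open>k \<ge> 1\<close>] opt(1,2), of e] opt(3)
    by (simp add: what[OF \<open>k \<ge> 1\<close>])
  then have "(t k)\<^sup>2 * (\<beta> * ?D\<^sup>2) \<le> (t k)\<^sup>2 * (?\<Phi> (lam k) - ?\<Phi> lam_star)"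
    by (intro mult_left_mono) simp_all
  \<comment> \<open>The bound (k + 1)/2 on \<open>t k\<close> is weakened to k/2 here, whence k in
    the final rate.\<close>
  moreover have "(real k / 2)\<^sup>2 * (\<beta> * ?D\<^sup>2) \<le> (t k)\<^sup>2 * (\<beta> * ?D\<^sup>2)"
    using fista_t_ge[OF t_1 t \<open>k \<ge> 1\<close>] \<open>\<beta> > 0\<close> by (intro mult_right_mono power_mono) simp_all
  ultimately have "(real k / 2)\<^sup>2 * (\<beta> * ?D\<^sup>2) \<le> L / 2 * ?R\<^sup>2"
    using gap by linarith
  \<comment> \<open>The factor 4 \<beta> makes the left side a perfect square and cancels the
    denominator of \<open>L\<close>.\<close>
  then have "4 * \<beta> * ((real k / 2)\<^sup>2 * (\<beta> * ?D\<^sup>2)) \<le> 4 * \<beta> * (L / 2 * ?R\<^sup>2)"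
    using \<open>\<beta> > 0\<close> by (intro mult_left_mono) simp_all
  moreover have "4 * \<beta> * (L / 2 * ?R\<^sup>2) = 2 * (real CARD('n) - 1) * ?R\<^sup>2"
    using \<open>\<beta> > 0\<close> by (simp add: L)
  moreover have "4 * \<beta> * ((real k / 2)\<^sup>2 * (\<beta> * ?D\<^sup>2)) = (\<beta> * real k * ?D)\<^sup>2"
    by (simp add: power2_eq_square)
  ultimately have "(\<beta> * real k * ?D)\<^sup>2 \<le> 2 * (real CARD('n) - 1) * ?R\<^sup>2" by (simp only:)
  then have "\<beta> * real k * ?D \<le> sqrt (2 * (real CARD('n) - 1) * ?R\<^sup>2)"
    by (rule real_le_rsqrt)
  also have "\<dots> = sqrt (2 * (real CARD('n) - 1)) * ?R"
    by (simp only: real_sqrt_mult real_sqrt_abs abs_norm_cancel)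
  finally have "\<beta> * real k * ?D \<le> sqrt (2 * (real CARD('n) - 1)) * ?R" .
  then show "?D \<le> sqrt (2 * (real CARD('n) - 1)) * ?R / (\<beta> * real k)"
    using \<open>\<beta> > 0\<close> \<open>k \<ge> 1\<close> by (simp add: field_simps)
qed

end
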